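(* Let $d\ge2$ be an integer, and for $0<q<1$ let $\theta_q$ be the probability measure on the finite set $\mathfrak{M}_d^{(n)}$ given by $$\theta_q\big(\mu^{(1)},\ldots,\mu^{(k)}\big)=\frac{1}{Z_q}\,W_q\big(\mu^{(1)},\ldots,\mu^{(k)}\big),$$ where $\mathfrak{M}_d^{(n)}$, $W_q$ and the normalizing constant $Z_q$ are as defined in the context. If $n\ge2d$, then, as $q\to0^+$, the measure $\theta_q$ converges weakly to the uniform measure $\nu$ on $\mathfrak{M}_{d,1}^{(n)}$, the set of single partitions $\mu^{(1)}$ of $n$ with colength $d$; that is, to the measure $$\nu(A)=\frac{|A\cap\mathfrak{M}_{d,1}^{(n)}|}{|\mathfrak{M}_{d,1}^{(n)}|},\qquad A\subseteq\mathfrak{M}_d^{(n)}.$$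
   Context: $\mathcal{P}_n$ is the set of integer partitions of $n$. For a partition $\mu$, $|\mu|$ is its weight, $\ell(\mu)$ its number of parts, and $\ell^*(\mu):=|\mu|-\ell(\mu)$ its colength. For $k\in\{1,\ldots,d\}$, $\mathfrak{M}_{d,k}^{(n)}$ is the set of all $k$-tuples $(\mu^{(1)},\ldots,\mu^{(k)})\in(\mathcal{P}_n)^k$ with $\ell^*(\mu^{(j)})\ne0$ for all $j$ and $\sum_{j=1}^k\ell^*(\mu^{(j)})=d$; and $\mathfrak{M}_d^{(n)}:=\coprod_{k=1}^d\mathfrak{M}_{d,k}^{(n)}$. For a tuple $(\mu^{(1)},\ldots,\mu^{(k)})\in\mathfrak{M}_{d,k}^{(n)}$, let $\lambda$ be the partition of $d$ whose parts are the colengths $\ell^*(\mu^{(1)}),\ldots,\ell^*(\mu^{(k)})$ in weakly decreasing order, and $|\mathrm{aut}(\lambda)|:=\prod_{i\ge1}m_i(\lambda)!$ with $m_i(\lambda)$ the number of parts of $\lambda$ equal to $i$. The weight is $$W_q(\mu^{(1)},\ldots,\mu^{(k)}):=\frac{1}{|\mathrm{aut}(\lambda)|}\sum_{\sigma\in S_k}\ \prod_{j=1}^{k}\frac{1}{q^{-\sum_{i=1}^{j}\ell^*(\mu^{(\sigma(i))})}-1}$$ (equivalently, the monomial symmetric function $m_\lambda$ evaluated at $(q,q^2,q^3,\ldots)$). The normalizing constant is $Z_q=\sum_{k=1}^d\sum_{(\mu^{(1)},\ldots,\mu^{(k)})\in\mathfrak{M}_{d,k}^{(n)}}W_q(\mu^{(1)},\ldots,\mu^{(k)})$.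 *)

theory Defs
  imports "HOL-Probability.Probability" "HOL-Combinatorics.Permutations"
begin

text \<open>
  An integer partition is the multiset of its (positive) parts.
\<close>

definition int_partitions :: "nat \<Rightarrow> nat multiset set" where
  "int_partitions n = {\<mu>. 0 \<notin># \<mu> \<and> sum_mset \<mu> = n}"

text \<open>
  All parts of a partition are positive, so the natural-number subtraction never truncates on
  partitions (lemma \<open>size_le_weight\<close>).
\<close>

definition colength :: "nat multiset \<Rightarrow> nat" where
  "colength \<mu> = sum_mset \<mu> - size \<mu>"

lemma size_le_weight: "0 \<notin># \<mu> \<Longrightarrow> size \<mu> \<le> sum_mset (\<mu> :: nat multiset)"
proof (induction \<mu>)
  case (add x \<mu>)
  then have "1 \<le> x" "size \<mu> \<le> sum_mset \<mu>" by auto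
  then show ?case by simp
qed simp

definition MM_k :: "nat \<Rightarrow> nat \<Rightarrow> nat \<Rightarrow> nat multiset list set" where
  "MM_k n d k = {\<mu>s. length \<mu>s = k \<and> set \<mu>s \<subseteq> int_partitions n \<and>
     (\<forall>\<mu>\<in>set \<mu>s. colength \<mu> \<noteq> 0) \<and> (\<Sum>\<mu>\<leftarrow>\<mu>s. colength \<mu>) = d}"

text \<open>
  The coproduct over \<open>k\<close> is a plain union, since the length of a list determines \<open>k\<close>.
\<close>

definition MM :: "nat \<Rightarrow> nat \<Rightarrow> nat multiset list set" where
  "MM n d = (\<Union>k\<in>{1..d}. MM_k n d k)"

definition colength_partition :: "nat multiset list \<Rightarrow> nat multiset" where
  "colength_partition \<mu>s = mset (map colength \<mu>s)"

text \<open>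
  Values \<open>i\<close> that are not parts have multiplicity \<open>0\<close> and would only contribute a factor
  \<open>0! = 1\<close>.
\<close>

definition aut_card :: "nat multiset \<Rightarrow> nat" where
  "aut_card lam = (\<Prod>i\<in>set_mset lam. fact (count lam i))"

text \<open>Indices of tuples start at \<open>0\<close>, so \<open>S\<^sub>k\<close> acts on \<open>{..<k}\<close>.\<close>

definition weight_W :: "real \<Rightarrow> nat multiset list \<Rightarrow> real" where
  "weight_W q \<mu>s = 1 / real (aut_card (colength_partition \<mu>s)) *
     (\<Sum>\<sigma> | \<sigma> permutes {..<length \<mu>s}.
        \<Prod>j<length \<mu>s. 1 / (q powi (- int (\<Sum>i\<le>j. colength (\<mu>s ! \<sigma> i))) - 1))"

definition norm_Z :: "nat \<Rightarrow> nat \<Rightarrow> real \<Rightarrow> real" where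
  "norm_Z n d q = (\<Sum>k=1..d. \<Sum>\<mu>s\<in>MM_k n d k. weight_W q \<mu>s)"

text \<open>
  For \<open>0 < q < 1\<close> all the point masses are nonnegative, so \<open>ennreal\<close> does not truncate, and
  this is a probability measure (lemma \<open>prob_space_theta\<close>).
\<close>

definition theta :: "nat \<Rightarrow> nat \<Rightarrow> real \<Rightarrow> nat multiset list measure" where
  "theta n d q = point_measure (MM n d) (\<lambda>\<mu>s. ennreal (1 / norm_Z n d q * weight_W q \<mu>s))"

definition nu :: "nat \<Rightarrow> nat \<Rightarrow> nat multiset list measure" where
  "nu n d = uniform_measure (count_space (MM n d)) (MM_k n d 1)"

text \<open>
  Weak convergence of finite Borel measures on a topological space \<open>X\<close>, along an arbitrary
  filter. The library's \<^const>\<open>weak_conv_m\<close> only covers sequences of measures on the real line.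
\<close>

definition weak_conv_on ::
  "'b topology \<Rightarrow> ('a \<Rightarrow> 'b measure) \<Rightarrow> 'b measure \<Rightarrow> 'a filter \<Rightarrow> bool" where
  "weak_conv_on X M N F \<longleftrightarrow>
     (\<forall>f :: 'b \<Rightarrow> real. continuous_map X euclideanreal f \<and> bounded (f ` topspace X) \<longrightarrow>
        ((\<lambda>t. integral\<^sup>L (M t) f) \<longlongrightarrow> integral\<^sup>L N f) F)"

lemma finite_int_partitions: "finite (int_partitions n)"
proof -
  have "int_partitions n \<subseteq> (\<lambda>xs. mset xs) ` {xs. set xs \<subseteq> {..n} \<and> length xs \<le> n}"
  proof
    fix \<mu> assume \<mu>: "\<mu> \<in> int_partitions n"
    obtain xs where xs: "mset xs = \<mu>" using ex_mset by blast
    have "size \<mu> \<le> n" using \<mu> size_le_weight by (auto simp: int_partitions_def)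
    moreover have "x \<le> n" if "x \<in># \<mu>" for x
      using \<mu> that sum_mset.remove[OF that] by (auto simp: int_partitions_def)
    ultimately show "\<mu> \<in> (\<lambda>xs. mset xs) ` {xs. set xs \<subseteq> {..n} \<and> length xs \<le> n}"
      using xs by (intro image_eqI[of _ _ xs]) auto
  qed
  then show ?thesis
    by (rule finite_subset) (intro finite_imageI finite_lists_length_le, simp)
qed

lemma finite_MM_k: "finite (MM_k n d k)"
  by (rule finite_subset[OF _ finite_lists_length_eq[OF finite_int_partitions[of n], of k]])
     (auto simp: MM_k_def)

lemma finite_MM: "finite (MM n d)"
  by (simp add: MM_def finite_MM_k)

lemma MM_k_1_nonempty:
  assumes "1 \<le> d" "2 * d \<le> n"
  shows "MM_k n d 1 \<noteq> {}"
proof -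
  have "[add_mset (d + 1) (replicate_mset (n - d - 1) 1)] \<in> MM_k n d 1"
    using assms by (auto simp: MM_k_def int_partitions_def colength_def)
  then show ?thesis by blast
qed

lemma norm_Z_eq: "norm_Z n d q = (\<Sum>\<mu>s\<in>MM n d. weight_W q \<mu>s)"
  unfolding norm_Z_def MM_def
  by (rule sum.UNION_disjoint[symmetric]) (auto simp: finite_MM_k, auto simp: MM_k_def)

lemma weight_W_pos:
  assumes q: "0 < q" "q < 1" and \<mu>s: "\<mu>s \<in> MM n d"
  shows "0 < weight_W q \<mu>s"
proof -
  let ?k = "length \<mu>s"
  have nz: "colength (\<mu>s ! i) > 0" if "i < ?k" for i
    using \<mu>s that by (auto simp: MM_def MM_k_def)
  have fac: "0 < 1 / (q powi (- int (\<Sum>i\<le>j. colength (\<mu>s ! \<sigma> i))) - 1)"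
    if "\<sigma> permutes {..<?k}" "j < ?k" for \<sigma> j
  proof -
    have "\<sigma> j < ?k" using permutes_in_image[OF that(1), of j] that(2) by simp
    then have "0 < colength (\<mu>s ! \<sigma> j)" by (rule nz)
    also have "\<dots> \<le> (\<Sum>i\<le>j. colength (\<mu>s ! \<sigma> i))"
      by (rule member_le_sum) auto
    finally have s: "0 < (\<Sum>i\<le>j. colength (\<mu>s ! \<sigma> i))" (is "0 < ?s") .
    have "q ^ ?s < 1" using q s by (metis power_Suc_less_one gr0_implies_Suc)
    then have "1 < q powi (- int ?s)"
      using q by (simp only: power_int_minus power_int_of_nat) (simp add: one_less_inverse_iff)
    then show ?thesis by simp
  qed
  have "0 < (\<Sum>\<sigma> | \<sigma> permutes {..<?k}.
        \<Prod>j<?k. 1 / (q powi (- int (\<Sum>i\<le>j. colength (\<mu>s ! \<sigma> i))) - 1))"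
  proof (intro sum_pos prod_pos finite_permutations)
    show "{\<sigma>. \<sigma> permutes {..<?k}} \<noteq> {}" using permutes_id by blast
  qed (use fac in auto)
  moreover have "0 < real (aut_card (colength_partition \<mu>s))"
    unfolding aut_card_def of_nat_0_less_iff by (intro prod_pos) (auto simp: fact_gt_zero)
  ultimately show ?thesis
    unfolding weight_W_def by simp
qed

lemma prob_space_theta:
  assumes "0 < q" "q < 1" "1 \<le> d" "2 * d \<le> n"
  shows "prob_space (theta n d q)"
proof -
  have "MM n d \<noteq> {}"
    using MM_k_1_nonempty[OF assms(3,4)] assms(3) by (auto simp: MM_def)
  then have Z: "0 < norm_Z n d q"
    unfolding norm_Z_eq by (intro sum_pos finite_MM weight_W_pos[OF assms(1,2)])
  have nn: "0 \<le> 1 / norm_Z n d q * weight_W q \<mu>s" if "\<mu>s \<in> MM n d" for \<mu>s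
    using weight_W_pos[OF assms(1,2) that] Z by simp
  have "(\<Sum>\<mu>s\<in>MM n d. 1 / norm_Z n d q * weight_W q \<mu>s) = 1"
    using Z by (simp only: sum_distrib_left[symmetric] norm_Z_eq[symmetric]) simp
  then have "(\<Sum>\<mu>s\<in>MM n d. ennreal (1 / norm_Z n d q * weight_W q \<mu>s)) = 1"
    by (subst sum_ennreal) (use nn in auto)
  then show ?thesis
    unfolding theta_def by (intro prob_space_point_measure finite_MM) auto
qed

lemma measure_nu:
  assumes "1 \<le> d" "2 * d \<le> n" "A \<subseteq> MM n d"
  shows "measure (nu n d) A = real (card (A \<inter> MM_k n d 1)) / real (card (MM_k n d 1))"
proof -
  have sub: "MM_k n d 1 \<subseteq> MM n d" using assms(1) by (auto simp: MM_def)
  have e: "emeasure (count_space (MM n d)) (MM_k n d 1) = of_nat (card (MM_k n d 1))"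
    using sub by (simp add: emeasure_count_space_finite finite_MM_k)
  have "card (MM_k n d 1) \<noteq> 0"
    using MM_k_1_nonempty[OF assms(1,2)] finite_MM_k by simp
  then have "measure (nu n d) A
      = measure (count_space (MM n d)) (MM_k n d 1 \<inter> A) / measure (count_space (MM n d)) (MM_k n d 1)"
    unfolding nu_def using assms(3) e by (intro measure_uniform_measure) auto
  also have "\<dots> = real (card (A \<inter> MM_k n d 1)) / real (card (MM_k n d 1))"
    using sub assms(3) finite_MM_k[of n d 1]
    by (simp add: measure_def emeasure_count_space_finite le_infI1 Int_commute finite_Int)
  finally show ?thesis .
qed

end

theory Submission
  imports Defs
begin

text \<open>
  After division by \<open>q ^ d\<close> every weight has a limit as \<open>q\<close> tends to \<open>0\<close> from the right. In each
  product the last partial sum of colengths is \<open>d\<close>, so the last factor is asymptotic to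
  \<open>q ^ d\<close>, while every earlier factor tends to \<open>0\<close>. Hence the limit is \<open>1\<close> for a
  single partition and \<open>0\<close> for longer tuples. The factor \<open>q ^ d\<close> cancels in the normalized
  weights, and the space is finite, so integrals converge termwise.
\<close>

lemma inverse_powi_minus_one:
  fixes q :: real
  assumes "q \<noteq> 0"
  shows "1 / (q powi (- int s) - 1) = q ^ s / (1 - q ^ s)"
proof -
  \<comment> \<open>At \<open>x = 1\<close> both denominators vanish and both sides are 0, since
    division by zero yields 0; otherwise multiply through by \<open>x\<close>.\<close>
  have "1 / (inverse x - 1) = x / (1 - x)" if "x \<noteq> 0" for x :: real
    using that by (cases "x = 1") (auto simp: field_simps)
  from this[of "q ^ s"] assms show ?thesis
    by (simp add: power_int_minus)
qed

lemma tendsto_power_at_right_0: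
  assumes "0 < s"
  shows "((\<lambda>q::real. q ^ s) \<longlongrightarrow> 0) (at_right 0)"
  by (rule tendsto_eq_intros | use assms in simp)+

lemma tendsto_factor:
  assumes "0 < s"
  shows "((\<lambda>q::real. 1 / (q powi (- int s) - 1)) \<longlongrightarrow> 0) (at_right 0)"
proof -
  have "((\<lambda>q::real. q ^ s / (1 - q ^ s)) \<longlongrightarrow> 0 / (1 - 0)) (at_right 0)"
    by (intro tendsto_intros tendsto_power_at_right_0 assms) simp
  moreover have "\<forall>\<^sub>F q::real in at_right 0. q ^ s / (1 - q ^ s) = 1 / (q powi (- int s) - 1)"
    using eventually_at_right_less[of "0::real"]
    by eventually_elim (simp add: inverse_powi_minus_one del: power_int_minus)
  ultimately show ?thesis
    by (simp add: tendsto_cong)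
qed

text \<open>The quotient equals \<open>1 / (1 - q ^ s)\<close> for positive \<open>q\<close>, so
  each factor is exactly of order \<open>q ^ s\<close>.\<close>

lemma tendsto_factor_scaled:
  assumes "0 < s"
  shows "((\<lambda>q::real. 1 / (q powi (- int s) - 1) / q ^ s) \<longlongrightarrow> 1) (at_right 0)"
proof -
  have "((\<lambda>q::real. 1 / (1 - q ^ s)) \<longlongrightarrow> 1 / (1 - 0)) (at_right 0)"
    by (intro tendsto_intros tendsto_power_at_right_0 assms) simp
  moreover have "\<forall>\<^sub>F q::real in at_right 0. 1 / (1 - q ^ s) = 1 / (q powi (- int s) - 1) / q ^ s"
    using eventually_at_right_less[of "0::real"]
    by eventually_elim (simp add: inverse_powi_minus_one del: power_int_minus)
  ultimately show ?thesis
    by (simp add: tendsto_cong)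
qed

text \<open>The whole power of \<open>q\<close> is charged to the last factor, which then tends to
  1; the \<open>m\<close> earlier factors tend to 0 unscaled. As \<open>0 ^ 0 = 1\<close>, the limit
  \<open>0 ^ m\<close> singles out products with one factor.\<close>

lemma tendsto_summand_scaled:
  fixes c :: "nat \<Rightarrow> nat"
  assumes pos: "\<And>i. i \<le> m \<Longrightarrow> 0 < c i"
  shows "((\<lambda>q::real. (\<Prod>j<Suc m. 1 / (q powi (- int (\<Sum>i\<le>j. c i)) - 1)) / q ^ (\<Sum>i\<le>m. c i))
           \<longlongrightarrow> 0 ^ m) (at_right 0)"
proof -
  have s: "0 < (\<Sum>i\<le>j. c i)" if "j \<le> m" for j
    using pos that by (intro sum_pos) auto
  have "((\<lambda>q::real. (\<Prod>j<m. 1 / (q powi (- int (\<Sum>i\<le>j. c i)) - 1)) *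
          (1 / (q powi (- int (\<Sum>i\<le>m. c i)) - 1) / q ^ (\<Sum>i\<le>m. c i)))
           \<longlongrightarrow> (\<Prod>j<m. 0) * 1) (at_right 0)"
    by (intro tendsto_mult tendsto_prod tendsto_factor tendsto_factor_scaled s) auto
  then show ?thesis
    by (simp only: prod.lessThan_Suc prod_constant card_lessThan mult_1_right times_divide_eq_right)
qed

lemma MM_k_1_eq:
  assumes "1 \<le> d"
  shows "MM_k n d 1 = {\<mu>s \<in> MM n d. length \<mu>s = 1}"
  using assms by (auto simp: MM_def MM_k_def)

lemma tendsto_weight_W_scaled:
  assumes \<mu>s: "\<mu>s \<in> MM n d"
  shows "((\<lambda>q. weight_W q \<mu>s / q ^ d) \<longlongrightarrow> of_bool (length \<mu>s = 1)) (at_right 0)"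
proof -
  let ?a = "real (aut_card (colength_partition \<mu>s))"
  obtain m where m: "length \<mu>s = Suc m"
    using \<mu>s by (cases "length \<mu>s") (auto simp: MM_def MM_k_def)
  have nz: "0 < colength (\<mu>s ! i)" if "i < length \<mu>s" for i
    using \<mu>s that by (auto simp: MM_def MM_k_def)
  \<comment> \<open>The last partial sum runs over all entries, hence does not depend on the
    permutation, and one power \<open>q ^ d\<close> scales every summand.\<close>
  have sum_d: "(\<Sum>i\<le>m. colength (\<mu>s ! \<sigma> i)) = d" if "\<sigma> permutes {..<length \<mu>s}" for \<sigma>
  proof -
    have "(\<Sum>i\<le>m. colength (\<mu>s ! \<sigma> i)) = (\<Sum>i<length \<mu>s. colength (\<mu>s ! \<sigma> i))"
      by (simp add: m lessThan_Suc_atMost)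
    also have "\<dots> = (\<Sum>i<length \<mu>s. colength (\<mu>s ! i))"
      using sum.permute[OF that, of "\<lambda>i. colength (\<mu>s ! i)"] by (simp add: o_def)
    also have "\<dots> = (\<Sum>\<mu>\<leftarrow>\<mu>s. colength \<mu>)"
      by (simp add: sum_list_sum_nth atLeast0LessThan)
    also have "\<dots> = d"
      using \<mu>s by (auto simp: MM_def MM_k_def)
    finally show ?thesis .
  qed
  have "((\<lambda>q. (\<Prod>j<Suc m. 1 / (q powi (- int (\<Sum>i\<le>j. colength (\<mu>s ! \<sigma> i))) - 1)) / q ^ d)
      \<longlongrightarrow> (0::real) ^ m) (at_right 0)" if "\<sigma> permutes {..<length \<mu>s}" for \<sigma>
  proof -
    have "0 < colength (\<mu>s ! \<sigma> i)" if "i \<le> m" for i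
      using nz permutes_in_image[OF \<open>\<sigma> permutes _\<close>, of i] that m by simp
    from tendsto_summand_scaled[of m "\<lambda>i. colength (\<mu>s ! \<sigma> i)", OF this] show ?thesis
      by (simp only: sum_d[OF that])
  qed
  then have "((\<lambda>q. 1 / ?a * (\<Sum>\<sigma> | \<sigma> permutes {..<length \<mu>s}.
        (\<Prod>j<Suc m. 1 / (q powi (- int (\<Sum>i\<le>j. colength (\<mu>s ! \<sigma> i))) - 1)) / q ^ d))
      \<longlongrightarrow> 1 / ?a * (\<Sum>\<sigma> | \<sigma> permutes {..<length \<mu>s}. 0 ^ m)) (at_right 0)"
    by (intro tendsto_mult tendsto_const tendsto_sum) auto
  moreover have "1 / ?a * (\<Sum>\<sigma> | \<sigma> permutes {..<length \<mu>s}. 0 ^ m) = of_bool (length \<mu>s = 1)"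
  proof (cases m)
    case 0
    \<comment> \<open>A single entry leaves one permutation and a colength partition with one part,
      so both the sum and \<open>?a\<close> are 1.\<close>
    then obtain \<mu> where "\<mu>s = [\<mu>]" using m by (cases \<mu>s) auto
    then show ?thesis
      using 0 by (simp add: aut_card_def colength_partition_def card_permutations[OF refl])
  qed (simp add: m)
  ultimately show ?thesis
    unfolding weight_W_def m[symmetric]
    by (simp only: sum_divide_distrib[symmetric] times_divide_eq_right)
qed

text \<open>Dividing numerator and denominator by \<open>q ^ d\<close> gives each of them a finite
  limit at 0.\<close>

lemma integral_theta:
  assumes "0 < q" "q < 1"
  shows "integral\<^sup>L (theta n d q) f
       = (\<Sum>\<mu>s\<in>MM n d. weight_W q \<mu>s / q ^ d * f \<mu>s) / (\<Sum>\<mu>s\<in>MM n d. weight_W q \<mu>s / q ^ d)"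
proof -
  \<comment> \<open>Strict positivity may fail here, as \<open>MM n d\<close> may be empty;
    nonnegative point masses are enough.\<close>
  have "0 \<le> norm_Z n d q"
    unfolding norm_Z_eq by (intro sum_nonneg less_imp_le weight_W_pos assms)
  then have "integral\<^sup>L (theta n d q) f
      = (\<Sum>\<mu>s\<in>MM n d. (1 / norm_Z n d q * weight_W q \<mu>s) * f \<mu>s)"
    unfolding theta_def using weight_W_pos[OF assms]
    by (subst lebesgue_integral_point_measure_finite) (auto simp: finite_MM less_imp_le)
  also have "\<dots> = (\<Sum>\<mu>s\<in>MM n d. weight_W q \<mu>s * f \<mu>s) / (\<Sum>\<mu>s\<in>MM n d. weight_W q \<mu>s)"
    by (simp add: norm_Z_eq sum_divide_distrib)
  also have "\<dots> = ((\<Sum>\<mu>s\<in>MM n d. weight_W q \<mu>s * f \<mu>s) / q ^ d)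
      / ((\<Sum>\<mu>s\<in>MM n d. weight_W q \<mu>s) / q ^ d)"
    using assms(1) by simp
  finally show ?thesis
    by (simp only: sum_divide_distrib times_divide_eq_left)
qed

lemma integral_nu:
  assumes "1 \<le> d" "2 * d \<le> n"
  shows "integral\<^sup>L (nu n d) f = (\<Sum>\<mu>s\<in>MM_k n d 1. f \<mu>s) / card (MM_k n d 1)"
proof -
  let ?A = "MM_k n d 1"
  have sub: "?A \<subseteq> MM n d" using assms(1) by (auto simp: MM_def)
  have "0 < card ?A"
    using MM_k_1_nonempty[OF assms] finite_MM_k by (simp add: card_gt_0_iff)
  \<comment> \<open>As a point measure with mass \<open>1 / card ?A\<close> on \<open>?A\<close> and
    0 elsewhere, \<open>nu\<close> integrates as a finite sum.\<close>
  then have "nu n d = point_measure (MM n d) (\<lambda>\<mu>s. ennreal (indicator ?A \<mu>s / card ?A))"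
    unfolding nu_def uniform_measure_def point_measure_def
    using sub by (intro arg_cong2[where f = density])
      (auto simp: emeasure_count_space_finite finite_MM_k divide_ennreal[symmetric]
        ennreal_of_nat_eq_real_of_nat ennreal_indicator)
  then have "integral\<^sup>L (nu n d) f = (\<Sum>\<mu>s\<in>MM n d. indicator ?A \<mu>s / card ?A * f \<mu>s)"
    by (simp add: lebesgue_integral_point_measure_finite finite_MM)
  also have "\<dots> = (\<Sum>\<mu>s\<in>?A. f \<mu>s / card ?A)"
    using sub by (intro sum.mono_neutral_cong_right finite_MM) auto
  finally show ?thesis
    by (simp add: sum_divide_distrib)
qed

theorem corollary3p2:
  fixes n d :: nat
  assumes "d \<ge> 2" and "n \<ge> 2 * d"
  shows "weak_conv_on (discrete_topology (MM n d)) (\<lambda>q :: real. theta n d q) (nu n d) (at_right 0)"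
  unfolding weak_conv_on_def
proof (intro allI impI)
  fix f :: "nat multiset list \<Rightarrow> real"
  let ?A = "MM_k n d 1"
  let ?one = "\<lambda>\<mu>s :: nat multiset list. of_bool (length \<mu>s = 1) :: real"
  have d: "1 \<le> d" using assms by simp
  \<comment> \<open>The limit weights \<open>?one\<close> form the indicator of \<open>?A\<close>
    within \<open>MM n d\<close>.\<close>
  have sum_A: "(\<Sum>\<mu>s\<in>MM n d. ?one \<mu>s * g \<mu>s) = (\<Sum>\<mu>s\<in>?A. g \<mu>s)" for g :: "_ \<Rightarrow> real"
    unfolding MM_k_1_eq[OF d] by (intro sum.mono_neutral_cong_right finite_MM) auto
  have card_A: "(\<Sum>\<mu>s\<in>MM n d. ?one \<mu>s) = card ?A"
    using sum_A[of "\<lambda>_. 1"] by simp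
  \<comment> \<open>The denominator tends to \<open>card ?A\<close>; \<open>n \<ge> 2 * d\<close>
    provides a partition of colength \<open>d\<close>, so this limit is nonzero.\<close>
  have "card ?A \<noteq> 0"
    using MM_k_1_nonempty[OF d assms(2)] finite_MM_k by simp
  then have "((\<lambda>q. (\<Sum>\<mu>s\<in>MM n d. weight_W q \<mu>s / q ^ d * f \<mu>s)
        / (\<Sum>\<mu>s\<in>MM n d. weight_W q \<mu>s / q ^ d))
      \<longlongrightarrow> (\<Sum>\<mu>s\<in>MM n d. ?one \<mu>s * f \<mu>s) / (\<Sum>\<mu>s\<in>MM n d. ?one \<mu>s)) (at_right 0)"
    by (intro tendsto_divide tendsto_sum tendsto_mult tendsto_const tendsto_weight_W_scaled)
      (auto simp only: card_A of_nat_eq_0_iff)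
  moreover have "\<forall>\<^sub>F q in at_right 0. integral\<^sup>L (theta n d q) f
      = (\<Sum>\<mu>s\<in>MM n d. weight_W q \<mu>s / q ^ d * f \<mu>s) / (\<Sum>\<mu>s\<in>MM n d. weight_W q \<mu>s / q ^ d)"
    \<comment> \<open>The closed form holds for \<open>0 < q < 1\<close>, a right neighbourhood of
      0.\<close>
    using eventually_at_right_real[of 0 "1::real", OF zero_less_one]
    by eventually_elim (simp only: greaterThanLessThan_iff integral_theta)
  ultimately show "((\<lambda>q. integral\<^sup>L (theta n d q) f) \<longlongrightarrow> integral\<^sup>L (nu n d) f) (at_right 0)"
    by (simp only: tendsto_cong integral_nu[OF d assms(2)] sum_A card_A)
qed

end
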